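(* Let $(\Omega,\rho)$ be a compact metric space equipped with a Borel probability measure $P$, let $\mathbb{M}$ be a dense subset of $\Omega$, and let $f:\mathbb{M}\to\mathbb{R}$ be a bounded function. Then $f$ is Riemann integrable if and only if for every sequence $\{x_n\}$ of elements of $\mathbb{M}$ that is uniformly distributed in $\Omega$ there exists the proper (finite) limit $$\lim_{N\to\infty}\frac1N\sum_{n=1}^N f(x_n);$$ in this case this limit is equal to the Riemann integral $\int f$.
   Context: A sequence $\{a_n\}$ of elements of $\Omega$ is uniformly distributed in $\Omega$ if $\lim_{N\to\infty}\frac1N\sum_{n=1}^N g(a_n)=\int g\,dP$ for every continuous real function $g$ on $\Omega$. Let $C(\Omega)$ be the set of continuous real functions on $\Omega$. For a bounded function $f:\mathbb{M}\to\mathbb{R}$, the upper and lower Riemann integrals are $$\int^\ast f=\inf\Big\{\int g\,dP:\ g\in C(\Omega),\ g\ge f \text{ on } \mathbb{M}\Big\},\qquad \int_\ast f=\sup\Big\{\int g\,dP:\ g\in C(\Omega),\ g\le f\text{ on } \mathbb{M}\Big\}.$$ The function $f$ is Riemann integrable if $\int^\ast f=\int_\ast f$; this common value is the Riemann integral of $f$, denoted $\int f$. *)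

theory Defs
  imports "HOL-Probability.Probability"
begin

(* A compact metric space is a compact subset W of a type of class metric_space, with the
   restricted metric; the Borel sets of W are those of restrict_space borel W. Sequences are
   indexed from 1: the value at index 0 plays no role. *)

definition uniformly_distributed ::
    "'a::metric_space set \<Rightarrow> 'a measure \<Rightarrow> (nat \<Rightarrow> 'a) \<Rightarrow> bool" where
  "uniformly_distributed W P a \<longleftrightarrow>
     (\<forall>n\<ge>1. a n \<in> W) \<and>
     (\<forall>g::'a \<Rightarrow> real. continuous_on W g \<longrightarrow>
        (\<lambda>N. 1 / real N * (\<Sum>n=1..N. g (a n))) \<longlonglongrightarrow> (\<integral>x. g x \<partial>P))"

(* For f bounded on M and P a probability measure on W, the sets below are nonempty and bounded
   from the relevant side, so Inf and Sup are the genuine infimum and supremum. *)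

definition upper_riemann_integral ::
    "'a::metric_space set \<Rightarrow> 'a measure \<Rightarrow> 'a set \<Rightarrow> ('a \<Rightarrow> real) \<Rightarrow> real" where
  "upper_riemann_integral W P M f =
     Inf {\<integral>x. g x \<partial>P |g. continuous_on W g \<and> (\<forall>x\<in>M. g x \<ge> f x)}"

definition lower_riemann_integral ::
    "'a::metric_space set \<Rightarrow> 'a measure \<Rightarrow> 'a set \<Rightarrow> ('a \<Rightarrow> real) \<Rightarrow> real" where
  "lower_riemann_integral W P M f =
     Sup {\<integral>x. g x \<partial>P |g. continuous_on W g \<and> (\<forall>x\<in>M. g x \<le> f x)}"

definition riemann_integrable ::
    "'a::metric_space set \<Rightarrow> 'a measure \<Rightarrow> 'a set \<Rightarrow> ('a \<Rightarrow> real) \<Rightarrow> bool" where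
  "riemann_integrable W P M f \<longleftrightarrow>
     upper_riemann_integral W P M f = lower_riemann_integral W P M f"

(* Only meaningful when riemann_integrable W P M f holds, where it is the common value. *)
definition riemann_integral ::
    "'a::metric_space set \<Rightarrow> 'a measure \<Rightarrow> 'a set \<Rightarrow> ('a \<Rightarrow> real) \<Rightarrow> real" where
  "riemann_integral W P M f = upper_riemann_integral W P M f"

end

theory Submission
  imports Defs "HOL-Library.Discrete_Functions"
begin

text \<open>
  If \<open>f\<close> is Riemann integrable, its averages are squeezed between those of continuous minorants and
  majorants. Conversely, let \<open>L < U\<close> be the lower and upper integrals, let \<open>g\<^sub>i\<close> be continuous functions
  with dense span in \<open>C(\<Omega>)\<close>, and let \<open>c\<^sub>n \<in> {L, U}\<close> be a sequence without a limit in mean. Choose \<open>x\<^sub>n\<close>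
  greedily so that a weighted sum of squares of the partial sums of \<open>f(x\<^sub>n) - c\<^sub>n\<close> and \<open>g\<^sub>i(x\<^sub>n) - \<integral>g\<^sub>i\<close>
  grows at most linearly; the very definition of \<open>L\<close> and \<open>U\<close> guarantees that such a choice exists
  in the dense set. All these partial sums are then \<open>o(N)\<close>, so \<open>x\<close> is uniformly distributed while
  the averages of \<open>f(x\<^sub>n)\<close> follow those of \<open>c\<^sub>n\<close> and diverge.
\<close>

section \<open>Greedy selection by a quadratic potential\<close>

text \<open>A potential argument: with \<open>s n i\<close> the partial sums, \<open>balance\<close>
  lets each choice keep the cross term of the weighted sum of squares at most 1, so the potential
  grows by at most a constant \<open>C\<close> per step. Hence \<open>s N i\<close> is of order at
  most the square root of \<open>N\<close> for each fixed \<open>i\<close>. Step \<open>n\<close>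
  involves only the coordinates below \<open>n\<close>, so each choice meets finitely many
  conditions.\<close>

lemma greedy_averages_tendsto_0:
  fixes D :: "nat \<Rightarrow> nat \<Rightarrow> 'a \<Rightarrow> real" and K :: real
  assumes bound: "\<And>i n x. x \<in> M \<Longrightarrow> \<bar>D i n x\<bar> \<le> K"
    and balance: "\<And>n t. \<exists>x\<in>M. (\<Sum>i<Suc n. t i * D i (Suc n) x) \<le> 1"
  obtains x where "\<forall>n. x n \<in> M"
    and "\<forall>i. (\<lambda>N. 1 / real N * (\<Sum>n=1..N. D i n (x n))) \<longlonglongrightarrow> 0"
proof -
  \<comment> \<open>The weights are summable, which controls all squared increments at once, and
    \<open>w n\<close> cancels \<open>real (Suc n) ^ 2\<close>, which controls the square that
    coordinate \<open>n\<close> has accumulated before it enters the potential.\<close>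
  define w :: "nat \<Rightarrow> real" where "w i = inverse (real (Suc i) ^ 2)" for i
  have w_pos: "w i > 0" for i
    by (simp add: w_def)
  have "summable w"
    unfolding w_def
    using summable_Suc_iff[of "\<lambda>n. inverse (real n ^ 2)"] inverse_power_summable[of 2, where 'a=real]
    by simp
  then have sum_w: "(\<Sum>i<n. w i) \<le> suminf w" for n
    by (intro sum_le_suminf) (auto simp: w_pos less_imp_le)
  define pick where
    "pick n s = (SOME x. x \<in> M \<and> (\<Sum>i<n. w i * s i * D i n x) \<le> 1)" for n :: nat and s :: "nat \<Rightarrow> real"
  have pick: "pick (Suc n) s \<in> M \<and> (\<Sum>i<Suc n. w i * s i * D i (Suc n) (pick (Suc n) s)) \<le> 1" for n :: nat and s
    unfolding pick_def
    by (rule someI_ex) (use balance[where n=n and t="\<lambda>i. w i * s i"] in auto)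
  define s where "s = rec_nat (\<lambda>i. 0) (\<lambda>n s i. s i + D i (Suc n) (pick (Suc n) s))"
  \<comment> \<open>Truncated subtraction makes \<open>x 0 = x 1\<close>, so that membership in
    \<open>M\<close> holds at every index; the sums start at 1.\<close>
  define x where "x n = pick (Suc (n - 1)) (s (n - 1))" for n
  have s_Suc: "s (Suc n) i = s n i + D i (Suc n) (x (Suc n))" for n i
    by (simp add: s_def x_def)
  have x_in: "x n \<in> M" for n
    using pick by (simp add: x_def)
  have s_sum: "s N i = (\<Sum>n=1..N. D i n (x n))" for N i
  proof (induction N)
    case 0
    show ?case by (simp add: s_def)
  next
    case (Suc N)
    then show ?case by (simp add: s_Suc)
  qed
  have s_bound: "\<bar>s n i\<bar> \<le> real n * K" for n i
  proof -
    have "\<bar>s n i\<bar> \<le> (\<Sum>k=1..n. \<bar>D i k (x k)\<bar>)"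
      unfolding s_sum by (rule sum_abs)
    also have "\<dots> \<le> (\<Sum>k=1..n. K)"
      by (intro sum_mono bound x_in)
    finally show ?thesis by simp
  qed
  define C where "C = 2 + K\<^sup>2 + K\<^sup>2 * suminf w"
  have V: "(\<Sum>i<n. w i * (s n i)\<^sup>2) \<le> real n * C" for n
  proof (induction n)
    case 0
    show ?case by simp
  next
    case (Suc n)
    define d where "d i = D i (Suc n) (x (Suc n))" for i
    have d_bound: "(d i)\<^sup>2 \<le> K\<^sup>2" for i
      using power_mono[OF bound[OF x_in], of i "Suc n" "Suc n" 2] by (simp add: d_def)
    have "(\<Sum>i<Suc n. w i * (s (Suc n) i)\<^sup>2)
        = (\<Sum>i<Suc n. w i * (s n i)\<^sup>2 + 2 * (w i * s n i * d i) + w i * (d i)\<^sup>2)"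
      by (intro sum.cong refl) (simp add: s_Suc d_def power2_eq_square algebra_simps)
    also have "\<dots> = (\<Sum>i<n. w i * (s n i)\<^sup>2) + w n * (s n n)\<^sup>2
        + 2 * (\<Sum>i<Suc n. w i * s n i * d i) + (\<Sum>i<Suc n. w i * (d i)\<^sup>2)"
      by (simp add: sum.distrib sum_distrib_left)
    also have "\<dots> \<le> real n * C + K\<^sup>2 + 2 * 1 + K\<^sup>2 * suminf w"
    proof (intro add_mono mult_left_mono)
      have "w n * (s n n)\<^sup>2 \<le> w n * (real (Suc n) ^ 2 * K\<^sup>2)"
      proof (intro mult_left_mono)
        have "\<bar>s n n\<bar>\<^sup>2 \<le> (real n * K)\<^sup>2"
          by (intro power_mono s_bound) auto
        also have "\<dots> \<le> real (Suc n) ^ 2 * K\<^sup>2"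
          unfolding power_mult_distrib by (intro mult_right_mono power_mono) auto
        finally show "(s n n)\<^sup>2 \<le> real (Suc n) ^ 2 * K\<^sup>2" by simp
      qed (use w_pos in \<open>auto simp: less_imp_le\<close>)
      also have "\<dots> = K\<^sup>2" by (simp add: w_def field_simps del: of_nat_Suc)
      finally show "w n * (s n n)\<^sup>2 \<le> K\<^sup>2" .
      show "(\<Sum>i<Suc n. w i * s n i * d i) \<le> 1"
        using pick[of n "s n"] by (simp add: d_def x_def)
      have "(\<Sum>i<Suc n. w i * (d i)\<^sup>2) \<le> (\<Sum>i<Suc n. w i * K\<^sup>2)"
        by (intro sum_mono mult_left_mono d_bound) (auto simp: w_pos less_imp_le)
      also have "\<dots> \<le> K\<^sup>2 * suminf w"
        unfolding sum_distrib_right[symmetric]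
        using mult_left_mono[OF sum_w[of "Suc n"], of "K\<^sup>2"] by (simp add: mult.commute)
      finally show "(\<Sum>i<Suc n. w i * (d i)\<^sup>2) \<le> K\<^sup>2 * suminf w" .
    qed (use Suc in auto)
    also have "\<dots> = real (Suc n) * C"
      by (simp add: C_def algebra_simps)
    finally show ?case .
  qed
  have "(\<lambda>N. 1 / real N * s N i) \<longlonglongrightarrow> 0" for i
  proof -
    \<comment> \<open>Once \<open>N > i\<close>, the single term of index \<open>i\<close> is at
      most the whole potential, which is linear in \<open>N\<close>; division by the square of
      \<open>N\<close> leaves a bound of order \<open>1 / N\<close>.\<close>
    have "(\<lambda>N. (1 / real N * s N i)\<^sup>2) \<longlonglongrightarrow> 0"
    proof (rule tendsto_sandwich[where f="\<lambda>_. 0" and h="\<lambda>N. C / w i * (1 / real N)"])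
      show "(\<lambda>N. C / w i * (1 / real N)) \<longlonglongrightarrow> 0"
        using tendsto_mult_right_zero[OF lim_1_over_n, of "C / w i"] by simp
      show "\<forall>\<^sub>F N in sequentially. (1 / real N * s N i)\<^sup>2 \<le> C / w i * (1 / real N)"
        using eventually_gt_at_top[of i]
      proof eventually_elim
        case (elim N)
        have "w i * (s N i)\<^sup>2 \<le> (\<Sum>i<N. w i * (s N i)\<^sup>2)"
          using elim by (intro member_le_sum) (auto simp: w_pos less_imp_le)
        also have "\<dots> \<le> real N * C" by (rule V)
        finally have "(s N i)\<^sup>2 \<le> real N * C / w i"
          using w_pos[of i] by (simp add: pos_le_divide_eq mult.commute)
        then have "(s N i)\<^sup>2 / (real N)\<^sup>2 \<le> (real N * C / w i) / (real N)\<^sup>2"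
          by (rule divide_right_mono) simp
        also have "\<dots> = C / w i * (1 / real N)"
          using elim by (simp add: power2_eq_square)
        finally show ?case by (simp add: power_divide)
      qed
    qed auto
    then show ?thesis by simp
  qed
  then show thesis
    using that[of x] x_in by (simp add: s_sum)
qed

section \<open>A countable family with dense span in the continuous functions\<close>

text \<open>Density of the linear span in the sup norm on \<open>W\<close>. Combinations are indexed
  by points because the construction below indexes its functions by the centres of balls.\<close>

definition uniformly_spans :: "'a::metric_space set \<Rightarrow> ('a \<Rightarrow> real) set \<Rightarrow> bool" where
  "uniformly_spans W G \<longleftrightarrow> (\<forall>h e. continuous_on W h \<longrightarrow> e > 0 \<longrightarrow>
     (\<exists>(F :: 'a set) c \<phi>. finite F \<and> (\<forall>q\<in>F. \<phi> q \<in> G) \<and>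
       (\<forall>x\<in>W. \<bar>h x - (\<Sum>q\<in>F. c q * \<phi> q x)\<bar> \<le> e)))"

text \<open>The family consists of partitions of unity subordinate to finite covers by balls of
  radius \<open>1 / real (Suc n)\<close>. By uniform continuity, weighting the functions of a fine
  partition with the values of \<open>h\<close> at the centres approximates \<open>h\<close>
  uniformly.\<close>

lemma compact_ex_countable_spanning:
  fixes W :: "'a::metric_space set"
  assumes "compact W"
  obtains G :: "('a \<Rightarrow> real) set" where "countable G" "G \<noteq> {}"
    and "\<forall>\<phi>\<in>G. continuous_on W \<phi>"
    and "\<forall>\<phi>\<in>G. \<forall>x\<in>W. \<bar>\<phi> x\<bar> \<le> 1"
    and "uniformly_spans W G"
proof -
  have "\<exists>F. finite F \<and> F \<subseteq> W \<and> W \<subseteq> (\<Union>q\<in>F. ball q (1 / real (Suc n)))" for n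
    using compactE_image[OF assms, of W "\<lambda>q. ball q (1 / real (Suc n))"] by fastforce
  then obtain F where F: "\<And>n. finite (F n)" "\<And>n. F n \<subseteq> W"
      "\<And>n. W \<subseteq> (\<Union>q\<in>F n. ball q (1 / real (Suc n)))"
    by metis
  \<comment> \<open>Tent functions supported on the balls of the cover; dividing by their sum,
    positive on \<open>W\<close>, gives the partition of unity.\<close>
  define \<psi> where "\<psi> n q x = max 0 (1 / real (Suc n) - dist q x)" for n and q x :: 'a
  define \<phi> where "\<phi> n q x = \<psi> n q x / (\<Sum>p\<in>F n. \<psi> n p x)" for n q x
  \<comment> \<open>Inserting the zero function keeps \<open>G\<close> nonempty even for empty
    \<open>W\<close>, so that it can be enumerated.\<close>
  define G where "G = insert (\<lambda>_. 0) (\<Union>n. \<phi> n ` F n)"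
  have \<psi>_nonneg: "\<psi> n q x \<ge> 0" for n q x
    by (simp add: \<psi>_def)
  have pos: "(\<Sum>p\<in>F n. \<psi> n p x) > 0" if "x \<in> W" for n x
  proof -
    obtain q where q: "q \<in> F n" "dist q x < 1 / real (Suc n)"
      using F(3)[of n] \<open>x \<in> W\<close> by auto
    then have "\<psi> n q x > 0" by (simp add: \<psi>_def)
    then show ?thesis
      using q(1) F(1) \<psi>_nonneg by (intro sum_pos2) auto
  qed
  have \<phi>_nonneg: "\<phi> n q x \<ge> 0" for n q x
    unfolding \<phi>_def by (intro divide_nonneg_nonneg sum_nonneg \<psi>_nonneg)
  have \<phi>_sum: "(\<Sum>q\<in>F n. \<phi> n q x) = 1" if "x \<in> W" for n x
    unfolding \<phi>_def sum_divide_distrib[symmetric] using pos[OF that, of n] by simp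
  have \<phi>_le: "\<phi> n q x \<le> 1" if "x \<in> W" "q \<in> F n" for n q x
    using member_le_sum[OF that(2), of "\<lambda>q. \<phi> n q x"] \<phi>_nonneg F(1) \<phi>_sum[OF that(1)] by auto
  have \<phi>_cont: "continuous_on W (\<phi> n q)" for n q
  proof -
    have "continuous_on W (\<psi> n q)" for n q
      unfolding \<psi>_def by (intro continuous_intros)
    then show ?thesis
      unfolding \<phi>_def using pos by (intro continuous_intros) (auto simp: less_imp_neq[symmetric])
  qed
  have approx: "\<exists>(F :: 'a set) c \<phi>. finite F \<and> (\<forall>q\<in>F. \<phi> q \<in> G) \<and>
        (\<forall>x\<in>W. \<bar>h x - (\<Sum>q\<in>F. c q * \<phi> q x)\<bar> \<le> e)"
    if h: "continuous_on W h" and e: "e > 0" for h e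
  proof -
    obtain d where d: "d > 0" "\<And>x y. x \<in> W \<Longrightarrow> y \<in> W \<Longrightarrow> dist y x < d \<Longrightarrow> dist (h y) (h x) < e"
      using compact_uniformly_continuous[OF h assms] e unfolding uniformly_continuous_on_def by metis
    obtain n where n: "1 / real (Suc n) < d"
      using reals_Archimedean[OF d(1)] by (auto simp: inverse_eq_divide)
    have "\<bar>h x - (\<Sum>q\<in>F n. h q * \<phi> n q x)\<bar> \<le> e" if x: "x \<in> W" for x
    proof -
      \<comment> \<open>As the weights sum to 1, the error is the weighted sum of
        \<open>h x - h q\<close>. Either \<open>q\<close> is close to \<open>x\<close> and the
        difference is small, or the weight vanishes.\<close>
      have "\<bar>(h x - h q) * \<phi> n q x\<bar> \<le> e * \<phi> n q x" if q: "q \<in> F n" for q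
      proof (cases "dist q x < 1 / real (Suc n)")
        case True
        then have "\<bar>h x - h q\<bar> \<le> e"
          using d(2)[of x q] n x q F(2)[of n] by (auto simp: dist_real_def)
        then show ?thesis
          using \<phi>_nonneg by (simp add: abs_mult mult_right_mono)
      next
        case False
        then show ?thesis by (simp add: \<phi>_def \<psi>_def)
      qed
      then have "\<bar>\<Sum>q\<in>F n. (h x - h q) * \<phi> n q x\<bar> \<le> (\<Sum>q\<in>F n. e * \<phi> n q x)"
        by (intro order_trans[OF sum_abs] sum_mono)
      also have "\<dots> = e"
        using \<phi>_sum[OF x, of n] by (simp add: sum_distrib_left[symmetric])
      finally show ?thesis
        using \<phi>_sum[OF x, of n]
        by (simp add: left_diff_distrib sum_subtractf sum_distrib_left[symmetric])
    qed
    then show ?thesis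
      using F(1) by (intro exI[of _ "F n"] exI[of _ h] exI[of _ "\<phi> n"]) (auto simp: G_def)
  qed
  show thesis
  proof (rule that[of G])
    show "countable G"
      unfolding G_def using F(1) by (intro countable_insert countable_UN) (auto intro: countable_finite)
    show "\<forall>\<phi>\<in>G. continuous_on W \<phi>"
      using \<phi>_cont by (auto simp: G_def)
    show "\<forall>\<phi>\<in>G. \<forall>x\<in>W. \<bar>\<phi> x\<bar> \<le> 1"
      using \<phi>_le \<phi>_nonneg by (auto simp: G_def)
    show "uniformly_spans W G"
      using approx unfolding uniformly_spans_def by blast
  qed (simp add: G_def)
qed

section \<open>A two-valued sequence without a mean\<close>

text \<open>The sequence is constant on the dyadic blocks from \<open>2 ^ k\<close> to
  \<open>2 ^ Suc k - 1\<close> and switches value from block to block. Each block is longer than all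
  that precedes it from index 1 on, so the averages cannot settle.\<close>

lemma ex_averages_not_convergent:
  fixes a b :: real
  assumes "a \<noteq> b"
  obtains c where "\<forall>n::nat. c n \<in> {a, b}"
    and "\<not> convergent (\<lambda>N. 1 / real N * (\<Sum>n=1..N. c n))"
proof -
  define c where "c n = (if even (floor_log n) then a else b)" for n
  define S where "S N = (\<Sum>n=1..N. c n)" for N
  have block: "S (2 ^ Suc k - 1) - S (2 ^ k - 1) = 2 ^ k * (if even k then a else b)" for k
  proof -
    have "{1..2 ^ Suc k - 1} = {1..2 ^ k - 1} \<union> {2 ^ k..<2 ^ Suc k :: nat}"
      using one_le_power[of "2::nat" k] by auto
    then have "S (2 ^ Suc k - 1) = S (2 ^ k - 1) + (\<Sum>n\<in>{2 ^ k..<2 ^ Suc k}. c n)"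
      unfolding S_def by (simp only:) (rule sum.union_disjoint, auto)
    also have "(\<Sum>n\<in>{2 ^ k..<2 ^ Suc k}. c n) = (\<Sum>n\<in>{2 ^ k..<2 ^ Suc k :: nat}. if even k then a else b)"
      by (intro sum.cong refl) (auto simp: c_def floor_log_eqI[of _ k] less_le_trans[of 0 "2 ^ k"])
    finally show ?thesis by simp
  qed
  have "\<not> convergent (\<lambda>N. 1 / real N * S N)"
  proof
    assume "convergent (\<lambda>N. 1 / real N * S N)"
    then obtain l where l: "(\<lambda>N. 1 / real N * S N) \<longlonglongrightarrow> l"
      by (auto simp: convergent_def)
    \<comment> \<open>Sampling at the ends of the blocks; the divisor \<open>2 ^ k - 1\<close> may
      be replaced by \<open>2 ^ k\<close> since their ratio tends to 1.\<close>
    have ratio: "(\<lambda>k. S (2 ^ k - 1) / 2 ^ k) \<longlonglongrightarrow> l"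
    proof -
      have "filterlim (\<lambda>k::nat. 2 ^ k - 1 :: nat) at_top sequentially"
        by (rule filterlim_at_top_mono[OF filterlim_ident])
           (auto simp: Suc_le_eq intro!: always_eventually le_diff_conv2[THEN iffD2])
      then have "(\<lambda>k. 1 / real (2 ^ k - 1) * S (2 ^ k - 1)) \<longlonglongrightarrow> l"
        by (rule filterlim_compose[OF l])
      moreover have "(\<lambda>k. real (2 ^ k - 1) / 2 ^ k) \<longlonglongrightarrow> 1"
      proof -
        have "(\<lambda>k. 1 - (1/2) ^ k :: real) \<longlonglongrightarrow> 1 - 0"
          by (intro tendsto_intros) auto
        then show ?thesis
          by (simp add: of_nat_diff power_one_over diff_divide_distrib)
      qed
      ultimately have "(\<lambda>k. 1 / real (2 ^ k - 1) * S (2 ^ k - 1) * (real (2 ^ k - 1) / 2 ^ k)) \<longlonglongrightarrow> l * 1"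
        by (rule tendsto_mult)
      moreover have "1 / real (2 ^ k - 1) * S (2 ^ k - 1) * (real (2 ^ k - 1) / 2 ^ k) = S (2 ^ k - 1) / 2 ^ k" for k
      proof (cases "k = 0")
        case False
        then have "(1::nat) < 2 ^ k" by (intro one_less_power) auto
        then have "2 ^ k - 1 \<noteq> (0::nat)" by linarith
        then have "real (2 ^ k - 1) \<noteq> 0" by (simp only: of_nat_eq_0_iff not_False_eq_True)
        then show ?thesis by (simp del: of_nat_diff)
      qed (simp add: S_def)
      ultimately show ?thesis by simp
    qed
    \<comment> \<open>This combination isolates the value on block \<open>k\<close>, so a limit of
      the averages would be a limit of the alternating block values.\<close>
    have "(\<lambda>k. 2 * (S (2 ^ Suc k - 1) / 2 ^ Suc k) - S (2 ^ k - 1) / 2 ^ k) \<longlonglongrightarrow> 2 * l - l"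
      by (intro tendsto_intros ratio LIMSEQ_Suc[OF ratio])
    moreover have "2 * (S (2 ^ Suc k - 1) / 2 ^ Suc k) - S (2 ^ k - 1) / 2 ^ k = (if even k then a else b)" for k
    proof -
      have "2 * (S (2 ^ Suc k - 1) / 2 ^ Suc k) - S (2 ^ k - 1) / 2 ^ k
          = (S (2 ^ Suc k - 1) - S (2 ^ k - 1)) / 2 ^ k"
        by (simp add: diff_divide_distrib)
      then show ?thesis unfolding block by simp
    qed
    ultimately have lim: "(\<lambda>k. if even k then a else b) \<longlonglongrightarrow> l" by simp
    have "filterlim (\<lambda>k::nat. 2 * k) at_top sequentially" "filterlim (\<lambda>k::nat. Suc (2 * k)) at_top sequentially"
      by (auto intro!: filterlim_subseq strict_monoI)
    from this[THEN filterlim_compose[OF lim]] have "l = a" "l = b"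
      by (simp_all add: tendsto_const_iff)
    with assms show False by simp
  qed
  then show thesis
    using that[of c] by (simp add: c_def S_def)
qed

section \<open>Continuous functions and uniform distribution on the compact space\<close>

locale compact_metric_prob_space = prob_space P for P :: "'a::metric_space measure" +
  fixes W M :: "'a set"
  assumes compact: "compact W"
    and sets_eq: "sets P = sets (restrict_space borel W)"
    and subset: "M \<subseteq> W"
    and dense: "W \<subseteq> closure M"
begin

lemma space_eq: "space P = W"
  using sets_eq_imp_space_eq[OF sets_eq] by (simp add: space_restrict_space)

lemma integrable_continuous:
  fixes g :: "'a \<Rightarrow> real"
  assumes "continuous_on W g"
  shows "integrable P g"
proof -
  have "bounded (g ` W)"
    using compact_continuous_image[OF assms compact] by (rule compact_imp_bounded)
  then obtain B where "\<forall>x\<in>W. norm (g x) \<le> B"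
    by (auto simp: bounded_iff)
  moreover have "g \<in> borel_measurable P"
    using borel_measurable_continuous_on_restrict[OF assms]
    by (simp add: measurable_cong_sets[OF sets_eq refl])
  ultimately show ?thesis
    by (intro integrable_const_bound[where B=B]) (auto simp: space_eq)
qed

lemma le_on_space:
  fixes g h :: "'a \<Rightarrow> real"
  assumes "continuous_on W g" "continuous_on W h" "\<And>x. x \<in> M \<Longrightarrow> g x \<le> h x" "x \<in> W"
  shows "g x \<le> h x"
proof -
  have cl: "closure M = W"
    using dense closure_minimal[OF subset compact_imp_closed[OF compact]] by blast
  have "continuous_on (closure M) (\<lambda>x. h x - g x)"
    unfolding cl by (intro continuous_intros assms)
  from continuous_ge_on_closure[OF this, of x 0] show ?thesis
    using assms by (auto simp: cl)
qed

lemma integral_mono_dense: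
  fixes g h :: "'a \<Rightarrow> real"
  assumes "continuous_on W g" "continuous_on W h" "\<And>x. x \<in> M \<Longrightarrow> g x \<le> h x"
  shows "(\<integral>x. g x \<partial>P) \<le> (\<integral>x. h x \<partial>P)"
  by (rule integral_mono) (simp_all add: integrable_continuous assms(1,2) le_on_space[OF assms] space_eq)

text \<open>Averaging and integration are linear and do not increase the sup norm, so convergence
  passes from \<open>G\<close> to its span and, by splitting \<open>e\<close> into thirds, to
  uniform limits.\<close>

lemma uniformly_distributedI_spanning:
  assumes x: "\<And>n. n \<ge> 1 \<Longrightarrow> x n \<in> W"
    and G: "\<And>\<phi>. \<phi> \<in> G \<Longrightarrow> continuous_on W \<phi>"
    and span: "uniformly_spans W G"
    and lim: "\<And>\<phi>. \<phi> \<in> G \<Longrightarrow> (\<lambda>N. 1 / real N * (\<Sum>n=1..N. \<phi> (x n))) \<longlonglongrightarrow> (\<integral>x. \<phi> x \<partial>P)"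
  shows "uniformly_distributed W P x"
  unfolding uniformly_distributed_def
proof (intro conjI allI impI)
  fix h :: "'a \<Rightarrow> real" assume h: "continuous_on W h"
  show "(\<lambda>N. 1 / real N * (\<Sum>n=1..N. h (x n))) \<longlonglongrightarrow> (\<integral>x. h x \<partial>P)"
  proof (rule LIMSEQ_I)
    fix e :: real assume "e > 0"
    then have "e / 3 > 0" by simp
    from span[unfolded uniformly_spans_def, rule_format, OF h this]
    obtain F :: "'a set" and c \<phi>
      where F: "finite F" "\<And>q. q \<in> F \<Longrightarrow> \<phi> q \<in> G"
        and near: "\<And>x. x \<in> W \<Longrightarrow> \<bar>h x - (\<Sum>q\<in>F. c q * \<phi> q x)\<bar> \<le> e / 3"
      by blast
    define k where "k x = (\<Sum>q\<in>F. c q * \<phi> q x)" for x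
    have k_cont: "continuous_on W k"
      unfolding k_def by (intro continuous_intros G F)
    have "(\<integral>x. k x \<partial>P) = (\<Sum>q\<in>F. c q * (\<integral>x. \<phi> q x \<partial>P))"
      unfolding k_def by (subst Bochner_Integration.integral_sum) (auto intro!: integrable_continuous G F)
    moreover have "1 / real N * (\<Sum>n=1..N. k (x n)) = (\<Sum>q\<in>F. c q * (1 / real N * (\<Sum>n=1..N. \<phi> q (x n))))" for N
      unfolding k_def by (subst sum.swap) (simp add: sum_distrib_left mult.left_commute)
    moreover have "(\<lambda>N. \<Sum>q\<in>F. c q * (1 / real N * (\<Sum>n=1..N. \<phi> q (x n)))) \<longlonglongrightarrow> (\<Sum>q\<in>F. c q * (\<integral>x. \<phi> q x \<partial>P))"
      by (intro tendsto_intros lim F)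
    ultimately have "(\<lambda>N. 1 / real N * (\<Sum>n=1..N. k (x n))) \<longlonglongrightarrow> (\<integral>x. k x \<partial>P)"
      by simp
    from LIMSEQ_D[OF this \<open>e / 3 > 0\<close>] obtain N0
      where N0: "\<And>N. N \<ge> N0 \<Longrightarrow> \<bar>1 / real N * (\<Sum>n=1..N. k (x n)) - (\<integral>x. k x \<partial>P)\<bar> < e / 3"
      by (auto simp: real_norm_def)
    have int: "\<bar>(\<integral>x. h x \<partial>P) - (\<integral>x. k x \<partial>P)\<bar> \<le> e / 3"
    proof -
      have i: "integrable P h" "integrable P k" "integrable P (\<lambda>x. \<bar>h x - k x\<bar>)"
        by (intro integrable_continuous continuous_intros h k_cont)+
      have "\<bar>(\<integral>x. h x \<partial>P) - (\<integral>x. k x \<partial>P)\<bar> = \<bar>\<integral>x. h x - k x \<partial>P\<bar>"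
        using i by simp
      also have "\<dots> \<le> (\<integral>x. \<bar>h x - k x\<bar> \<partial>P)" by (rule integral_abs_bound)
      also have "\<dots> \<le> (\<integral>x. e / 3 \<partial>P)"
        using near by (intro integral_mono i) (auto simp: k_def space_eq)
      finally show ?thesis by (simp add: prob_space)
    qed
    have avg: "\<bar>1 / real N * (\<Sum>n=1..N. h (x n)) - 1 / real N * (\<Sum>n=1..N. k (x n))\<bar> \<le> e / 3" for N
    proof -
      have "\<bar>\<Sum>n=1..N. h (x n) - k (x n)\<bar> \<le> (\<Sum>n=1..N. \<bar>h (x n) - k (x n)\<bar>)"
        by (rule sum_abs)
      also have "\<dots> \<le> (\<Sum>n=1..N. e / 3)"
        using near x by (intro sum_mono) (auto simp: k_def)
      finally have "1 / real N * \<bar>\<Sum>n=1..N. h (x n) - k (x n)\<bar> \<le> 1 / real N * (real N * (e / 3))"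
        by (intro mult_left_mono) auto
      \<comment> \<open>Only an inequality, since for \<open>N = 0\<close> the left side is
        0.\<close>
      also have "\<dots> \<le> e / 3"
        using \<open>e > 0\<close> by simp
      finally show ?thesis
        by (simp add: sum_subtractf diff_divide_distrib[symmetric])
    qed
    have "\<bar>1 / real N * (\<Sum>n=1..N. h (x n)) - (\<integral>x. h x \<partial>P)\<bar> < e" if "N \<ge> N0" for N
      using N0[OF that] int avg[of N] by linarith
    then show "\<exists>N0. \<forall>N\<ge>N0. norm (1 / real N * (\<Sum>n=1..N. h (x n)) - (\<integral>x. h x \<partial>P)) < e"
      by auto
  qed
qed (use x in auto)

end

section \<open>Upper and lower Riemann integrals\<close>

locale bounded_on_dense = compact_metric_prob_space P W M
  for P :: "'a::metric_space measure" and W M +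
  fixes f :: "'a \<Rightarrow> real"
  assumes bounded: "bounded (f ` M)"
begin

definition upper where "upper = upper_riemann_integral W P M f"
definition lower where "lower = lower_riemann_integral W P M f"

lemma ex_bound:
  obtains B where "\<And>x. x \<in> M \<Longrightarrow> \<bar>f x\<bar> \<le> B"
  using bounded that by (force simp: bounded_iff)

text \<open>A constant bound of \<open>f\<close> is a majorant. It makes the infimum meaningful and,
  since majorants dominate minorants, also bounds the set of the supremum from above.\<close>

lemma majorants_nonempty: "{\<integral>x. g x \<partial>P |g. continuous_on W g \<and> (\<forall>x\<in>M. g x \<ge> f x)} \<noteq> {}"
proof -
  obtain B where B: "\<And>x. x \<in> M \<Longrightarrow> \<bar>f x\<bar> \<le> B"
    using ex_bound by blast
  have "\<forall>x\<in>M. f x \<le> B" using B abs_le_D1 by blast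
  moreover have "continuous_on W (\<lambda>_. B)" by simp
  ultimately show ?thesis by blast
qed

lemma minorants_nonempty: "{\<integral>x. g x \<partial>P |g. continuous_on W g \<and> (\<forall>x\<in>M. g x \<le> f x)} \<noteq> {}"
proof -
  obtain B where B: "\<And>x. x \<in> M \<Longrightarrow> \<bar>f x\<bar> \<le> B"
    using ex_bound by blast
  have "- B \<le> f x" if "x \<in> M" for x
    using B[OF that] by linarith
  then have "\<forall>x\<in>M. - B \<le> f x" by blast
  moreover have "continuous_on W (\<lambda>_. - B)" by simp
  ultimately show ?thesis by blast
qed

lemma minorant_le_majorant:
  assumes "continuous_on W g" "\<forall>x\<in>M. g x \<le> f x" "continuous_on W h" "\<forall>x\<in>M. h x \<ge> f x"
  shows "(\<integral>x. g x \<partial>P) \<le> (\<integral>x. h x \<partial>P)"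
  using assms by (intro integral_mono_dense) (auto intro: order_trans)

lemma upper_le:
  assumes "continuous_on W g" "\<forall>x\<in>M. g x \<ge> f x"
  shows "upper \<le> (\<integral>x. g x \<partial>P)"
  unfolding upper_def upper_riemann_integral_def
proof (rule cInf_lower)
  show "bdd_below {\<integral>x. g x \<partial>P |g. continuous_on W g \<and> (\<forall>x\<in>M. g x \<ge> f x)}"
    using minorants_nonempty minorant_le_majorant unfolding bdd_below_def by blast
qed (use assms in blast)

lemma le_lower:
  assumes "continuous_on W g" "\<forall>x\<in>M. g x \<le> f x"
  shows "(\<integral>x. g x \<partial>P) \<le> lower"
  unfolding lower_def lower_riemann_integral_def
proof (rule cSup_upper)
  show "bdd_above {\<integral>x. g x \<partial>P |g. continuous_on W g \<and> (\<forall>x\<in>M. g x \<le> f x)}"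
    using majorants_nonempty minorant_le_majorant unfolding bdd_above_def by blast
qed (use assms in blast)

lemma upper_lessD:
  assumes "upper < a"
  obtains g where "continuous_on W g" "\<forall>x\<in>M. g x \<ge> f x" "(\<integral>x. g x \<partial>P) < a"
proof -
  obtain b where "b \<in> {\<integral>x. g x \<partial>P |g. continuous_on W g \<and> (\<forall>x\<in>M. g x \<ge> f x)}" "b < a"
    using cInf_lessD[OF majorants_nonempty assms[unfolded upper_def upper_riemann_integral_def]]
    by (elim bexE)
  then show thesis
    by (elim CollectE exE conjE) (rule that, simp_all)
qed

lemma less_lowerD:
  assumes "a < lower"
  obtains g where "continuous_on W g" "\<forall>x\<in>M. g x \<le> f x" "a < (\<integral>x. g x \<partial>P)"
proof -
  obtain b where "b \<in> {\<integral>x. g x \<partial>P |g. continuous_on W g \<and> (\<forall>x\<in>M. g x \<le> f x)}" "a < b"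
    using less_cSupD[OF minorants_nonempty assms[unfolded lower_def lower_riemann_integral_def]]
    by (elim bexE)
  then show thesis
    by (elim CollectE exE conjE) (rule that, simp_all)
qed

lemma lower_le_upper: "lower \<le> upper"
proof (rule ccontr)
  assume "\<not> ?thesis"
  then have "upper < lower" by simp
  then obtain g where g: "continuous_on W g" "\<forall>x\<in>M. g x \<le> f x" "upper < (\<integral>x. g x \<partial>P)"
    by (rule less_lowerD)
  from g(3) obtain h where h: "continuous_on W h" "\<forall>x\<in>M. h x \<ge> f x" "(\<integral>x. h x \<partial>P) < (\<integral>x. g x \<partial>P)"
    by (rule upper_lessD)
  show False
    using minorant_le_majorant[OF g(1,2) h(1,2)] h(3) by linarith
qed

section \<open>Convergence for integrable functions\<close>

text \<open>The squeeze in order form: for \<open>a\<close> below or above the common value, one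
  minorant or majorant has its integral on the same side of \<open>a\<close>, and its averages
  eventually stay there.\<close>

lemma averages_tendsto_of_integrable:
  assumes eq: "upper = lower"
    and x: "\<And>n. n \<ge> 1 \<Longrightarrow> x n \<in> M" and ud: "uniformly_distributed W P x"
  shows "(\<lambda>N. 1 / real N * (\<Sum>n=1..N. f (x n))) \<longlonglongrightarrow> upper"
proof (rule order_tendstoI)
  have lim: "(\<lambda>N. 1 / real N * (\<Sum>n=1..N. g (x n))) \<longlonglongrightarrow> (\<integral>x. g x \<partial>P)"
    if "continuous_on W g" for g
    using ud that by (auto simp: uniformly_distributed_def)
  fix a
  {
    assume "a < upper"
    then obtain g where g: "continuous_on W g" "\<forall>x\<in>M. g x \<le> f x" "a < (\<integral>x. g x \<partial>P)"
      unfolding eq by (rule less_lowerD)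
    have le: "1 / real N * (\<Sum>n=1..N. g (x n)) \<le> 1 / real N * (\<Sum>n=1..N. f (x n))" for N
      using g(2) x by (intro mult_left_mono sum_mono) auto
    show "\<forall>\<^sub>F N in sequentially. a < 1 / real N * (\<Sum>n=1..N. f (x n))"
      using order_tendstoD(1)[OF lim[OF g(1)] g(3)] by eventually_elim (rule less_le_trans[OF _ le])
  next
    assume "upper < a"
    then obtain g where g: "continuous_on W g" "\<forall>x\<in>M. g x \<ge> f x" "(\<integral>x. g x \<partial>P) < a"
      by (rule upper_lessD)
    have le: "1 / real N * (\<Sum>n=1..N. f (x n)) \<le> 1 / real N * (\<Sum>n=1..N. g (x n))" for N
      using g(2) x by (intro mult_left_mono sum_mono) auto
    show "\<forall>\<^sub>F N in sequentially. 1 / real N * (\<Sum>n=1..N. f (x n)) < a"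
      using order_tendstoD(2)[OF lim[OF g(1)] g(3)] by eventually_elim (rule le_less_trans[OF le])
  }
qed

section \<open>Divergent averages for non-integrable functions\<close>

text \<open>If no such \<open>x\<close> existed, solving the reverse inequality for \<open>f\<close> would give a continuous
  minorant with integral above \<open>lower\<close> or a continuous majorant with integral below \<open>upper\<close>.\<close>

lemma ex_balanced_point:
  assumes c: "lower \<le> c" "c \<le> upper"
    and H: "continuous_on W H" "(\<integral>x. H x \<partial>P) = 0"
  shows "\<exists>x\<in>M. t * (f x - c) + H x \<le> 1"
proof (rule ccontr)
  assume "\<not> ?thesis"
  then have gt: "1 < t * (f x - c) + H x" if "x \<in> M" for x
    using that by force
  \<comment> \<open>Solves \<open>t * (g x - c) + H x = 1\<close>. As \<open>H\<close> has mean 0,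
    the integral of \<open>g\<close> is \<open>c + 1 / t\<close>; the slack 1 puts it strictly
    beyond \<open>c\<close>, on the side given by the sign of \<open>t\<close>.\<close>
  define g where "g x = c + (1 - H x) / t" for x
  have g_cont: "continuous_on W g"
    unfolding g_def divide_inverse by (intro continuous_intros H)
  have g_int: "(\<integral>x. g x \<partial>P) = c + 1 / t"
    using integrable_continuous[OF H(1)] H(2)
    by (simp add: g_def prob_space)
  consider "t = 0" | "t > 0" | "t < 0" by linarith
  then show False
  proof cases
    \<comment> \<open>Here \<open>f\<close> drops out and \<open>H\<close> exceeds 1 on the dense
      set, which contradicts its mean 0.\<close>
    case 1
    then have "(\<integral>x. 1 \<partial>P) \<le> (\<integral>x. H x \<partial>P)"
      using gt by (intro integral_mono_dense H) (auto intro: less_imp_le)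
    then show False using H(2) by (simp add: prob_space)
  next
    case 2
    have "\<forall>x\<in>M. g x \<le> f x"
      using gt 2 by (force simp: g_def field_simps)
    from le_lower[OF g_cont this] have "c + 1 / t \<le> lower" by (simp only: g_int)
    moreover have "1 / t > 0" using 2 by simp
    ultimately show False using c by linarith
  next
    case 3
    have "\<forall>x\<in>M. g x \<ge> f x"
      using gt 3 by (force simp: g_def field_simps)
    from upper_le[OF g_cont this] have "upper \<le> c + 1 / t" by (simp only: g_int)
    moreover have "1 / t < 0" using 3 by simp
    ultimately show False using c by linarith
  qed
qed

text \<open>The greedy selection is applied to the error of \<open>f\<close> against
  \<open>c\<close> together with the centred functions of a spanning family, so one sequence
  achieves both aims.\<close>

lemma ex_uniformly_distributed_following:
  assumes c: "\<And>n. lower \<le> c n" "\<And>n. c n \<le> upper"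
  obtains x where "\<forall>n. x n \<in> M" "uniformly_distributed W P x"
    and "(\<lambda>N. 1 / real N * (\<Sum>n=1..N. f (x n) - c n)) \<longlonglongrightarrow> 0"
proof -
  obtain G where G: "countable G" "G \<noteq> {}" "\<forall>\<phi>\<in>G. continuous_on W \<phi>"
      "\<forall>\<phi>\<in>G. \<forall>x\<in>W. \<bar>\<phi> x\<bar> \<le> 1"
    and span: "uniformly_spans W G"
    by (rule compact_ex_countable_spanning[OF compact])
  define g where "g = from_nat_into G"
  have g: "g i \<in> G" for i
    using G(2) by (simp add: g_def from_nat_into)
  have g_cont: "continuous_on W (g i)" and g_le: "x \<in> W \<Longrightarrow> \<bar>g i x\<bar> \<le> 1" for i x
    using G g by auto
  obtain B where B: "\<And>x. x \<in> M \<Longrightarrow> \<bar>f x\<bar> \<le> B"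
    using ex_bound by blast
  define D where "D i n x = (case i of 0 \<Rightarrow> f x - c n | Suc i \<Rightarrow> g i x - (\<integral>x. g i x \<partial>P))" for i n x
  \<comment> \<open>The 2 bounds a function of absolute value at most 1 minus its mean; the other
    term bounds \<open>f x - c n\<close>, as \<open>c n\<close> lies between \<open>lower\<close>
    and \<open>upper\<close>.\<close>
  define K where "K = max 2 (B + \<bar>lower\<bar> + \<bar>upper\<bar>)"
  have D_bound: "\<bar>D i n x\<bar> \<le> K" if "x \<in> M" for i n x
  proof (cases i)
    case 0
    then show ?thesis using B[OF that] c[of n] by (simp add: D_def K_def)
  next
    case (Suc j)
    have "\<bar>\<integral>x. g j x \<partial>P\<bar> \<le> (\<integral>x. \<bar>g j x\<bar> \<partial>P)" by (rule integral_abs_bound)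
    also have "\<dots> \<le> (\<integral>x. 1 \<partial>P)"
      by (rule integral_mono) (simp_all add: integrable_continuous g_cont g_le space_eq)
    finally have "\<bar>\<integral>x. g j x \<partial>P\<bar> \<le> 1" by (simp add: prob_space)
    moreover have "\<bar>g j x\<bar> \<le> 1" using that subset by (auto intro: g_le)
    ultimately show ?thesis using Suc by (simp add: D_def K_def)
  qed
  have D_balance: "\<exists>x\<in>M. (\<Sum>i<Suc n. t i * D i (Suc n) x) \<le> 1" for n t
  proof -
    \<comment> \<open>All coordinates but the first merge into one continuous function of mean 0,
      which leaves the inequality of \<open>ex_balanced_point\<close>.\<close>
    define H where "H x = (\<Sum>i<n. t (Suc i) * (g i x - (\<integral>x. g i x \<partial>P)))" for x
    have "continuous_on W H"
      unfolding H_def by (intro continuous_intros g_cont)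
    moreover have "(\<integral>x. H x \<partial>P) = 0"
      unfolding H_def using integrable_continuous[OF g_cont]
      by (subst Bochner_Integration.integral_sum) (auto simp: prob_space)
    ultimately obtain x where "x \<in> M" "t 0 * (f x - c (Suc n)) + H x \<le> 1"
      using ex_balanced_point[OF c] by blast
    then show ?thesis
      by (intro bexI[of _ x]) (simp_all add: sum.lessThan_Suc_shift D_def H_def del: sum.lessThan_Suc)
  qed
  obtain x where x: "\<forall>n. x n \<in> M"
      and lim: "\<forall>i. (\<lambda>N. 1 / real N * (\<Sum>n=1..N. D i n (x n))) \<longlonglongrightarrow> 0"
    by (rule greedy_averages_tendsto_0[OF D_bound D_balance])
  show thesis
  proof (rule that)
    show "(\<lambda>N. 1 / real N * (\<Sum>n=1..N. f (x n) - c n)) \<longlonglongrightarrow> 0"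
      using spec[OF lim, of 0] by (simp add: D_def)
    show "uniformly_distributed W P x"
    proof (rule uniformly_distributedI_spanning[OF _ _ span])
      fix \<phi> assume "\<phi> \<in> G"
      then obtain i where i: "g i = \<phi>"
        unfolding g_def using from_nat_into_surj[OF G(1)] by blast
      let ?I = "\<integral>x. \<phi> x \<partial>P"
      have "(\<lambda>N. 1 / real N * (\<Sum>n=1..N. \<phi> (x n) - ?I) + ?I) \<longlonglongrightarrow> 0 + ?I"
        using spec[OF lim, of "Suc i"] by (intro tendsto_intros) (simp add: D_def i)
      \<comment> \<open>The average of the constant \<open>?I\<close> is \<open>?I\<close> only for
        \<open>N > 0\<close>, hence the eventual equality.\<close>
      moreover have "\<forall>\<^sub>F N in sequentially. 1 / real N * (\<Sum>n=1..N. \<phi> (x n) - ?I) + ?I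
          = 1 / real N * (\<Sum>n=1..N. \<phi> (x n))"
        using eventually_gt_at_top[of 0] by eventually_elim (simp add: sum_subtractf field_simps)
      ultimately show "(\<lambda>N. 1 / real N * (\<Sum>n=1..N. \<phi> (x n))) \<longlonglongrightarrow> ?I"
        by (simp add: tendsto_cong)
    qed (use x subset G in auto)
  qed (rule x)
qed

text \<open>The averages of \<open>f (x n)\<close> and of \<open>c n\<close> differ by a null
  sequence, so a limit of the former would force one of the latter.\<close>

lemma ex_averages_diverge_of_not_integrable:
  assumes "upper \<noteq> lower"
  obtains x where "\<forall>n. x n \<in> M" "uniformly_distributed W P x"
    and "\<not> convergent (\<lambda>N. 1 / real N * (\<Sum>n=1..N. f (x n)))"
proof -
  obtain c where c: "\<forall>n::nat. c n \<in> {upper, lower}"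
      and div: "\<not> convergent (\<lambda>N. 1 / real N * (\<Sum>n=1..N. c n))"
    by (rule ex_averages_not_convergent[OF assms])
  have "lower \<le> c n" "c n \<le> upper" for n
    using spec[OF c, of n] lower_le_upper by auto
  then obtain x where x: "\<forall>n. x n \<in> M" "uniformly_distributed W P x"
      and lim: "(\<lambda>N. 1 / real N * (\<Sum>n=1..N. f (x n) - c n)) \<longlonglongrightarrow> 0"
    by (rule ex_uniformly_distributed_following)
  have "\<not> convergent (\<lambda>N. 1 / real N * (\<Sum>n=1..N. f (x n)))"
  proof
    assume "convergent (\<lambda>N. 1 / real N * (\<Sum>n=1..N. f (x n)))"
    from convergent_diff[OF this convergentI[OF lim]] div show False
      by (simp add: sum_subtractf diff_divide_distrib)
  qed
  with x show thesis by (rule that)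
qed

section \<open>The equivalence and the value of the limit\<close>

lemma integrable_iff_averages_converge:
  shows "(riemann_integrable W P M f \<longleftrightarrow>
           (\<forall>x. (\<forall>n\<ge>1. x n \<in> M) \<and> uniformly_distributed W P x \<longrightarrow>
              convergent (\<lambda>N. 1 / real N * (\<Sum>n=1..N. f (x n))))) \<and>
         (riemann_integrable W P M f \<longrightarrow>
           (\<forall>x. (\<forall>n\<ge>1. x n \<in> M) \<and> uniformly_distributed W P x \<longrightarrow>
              (\<lambda>N. 1 / real N * (\<Sum>n=1..N. f (x n))) \<longlonglongrightarrow> riemann_integral W P M f))"
proof -
  let ?A = "\<lambda>x N. 1 / real N * (\<Sum>n=1..N. f (x n))"
  let ?ud = "\<lambda>x. (\<forall>n\<ge>1. x n \<in> M) \<and> uniformly_distributed W P x"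
  have integrable_iff: "riemann_integrable W P M f \<longleftrightarrow> upper = lower"
    by (simp add: riemann_integrable_def upper_def lower_def)
  have lim: "?A x \<longlonglongrightarrow> riemann_integral W P M f"
    if f: "riemann_integrable W P M f" and x: "?ud x" for x
    unfolding riemann_integral_def upper_def[symmetric]
  proof (rule averages_tendsto_of_integrable)
    show "upper = lower" using f by (simp only: integrable_iff)
  qed (use x in simp_all)
  have integrable: "riemann_integrable W P M f" if conv: "\<forall>x. ?ud x \<longrightarrow> convergent (?A x)"
  proof (rule ccontr)
    assume "\<not> riemann_integrable W P M f"
    then have "upper \<noteq> lower" by (simp only: integrable_iff not_False_eq_True)
    then obtain x where x: "\<forall>n. x n \<in> M" "uniformly_distributed W P x" "\<not> convergent (?A x)"
      by (rule ex_averages_diverge_of_not_integrable)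
    then have "?ud x" by simp
    with conv x(3) show False by simp
  qed
  show ?thesis
  proof (intro conjI iffI allI impI)
    show "convergent (?A x)" if "riemann_integrable W P M f" "?ud x" for x
      using lim[OF that] by (rule convergentI)
  qed (fact integrable lim)+
qed

end

theorem theorem2:
  fixes W M :: "'a::metric_space set"
    and P :: "'a measure"
    and f :: "'a \<Rightarrow> real"
  assumes "compact W"
    and "prob_space P"
    and "sets P = sets (restrict_space borel W)"
    and "M \<subseteq> W"
    and "W \<subseteq> closure M"
    and "bounded (f ` M)"
  shows "(riemann_integrable W P M f \<longleftrightarrow>
           (\<forall>x. (\<forall>n\<ge>1. x n \<in> M) \<and> uniformly_distributed W P x \<longrightarrow>
              convergent (\<lambda>N. 1 / real N * (\<Sum>n=1..N. f (x n))))) \<and>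
         (riemann_integrable W P M f \<longrightarrow>
           (\<forall>x. (\<forall>n\<ge>1. x n \<in> M) \<and> uniformly_distributed W P x \<longrightarrow>
              (\<lambda>N. 1 / real N * (\<Sum>n=1..N. f (x n))) \<longlonglongrightarrow> riemann_integral W P M f))"
proof -
  have "compact_metric_prob_space P W M"
    by (intro compact_metric_prob_space.intro compact_metric_prob_space_axioms.intro assms)
  then have "bounded_on_dense P W M f"
    by (intro bounded_on_dense.intro bounded_on_dense_axioms.intro assms)
  then show ?thesis
    by (rule bounded_on_dense.integrable_iff_averages_converge)
qed

end
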